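(* Let $\|\cdot\|_1$ and $\|\cdot\|_2$ be any two norms on $\mathbb{R}^d$, and for $r>0$ let $B_1(r), B_2(r)\subseteq\mathbb{R}^d$ be the closed balls of radius $r$ centered at the origin under $\|\cdot\|_1$ and $\|\cdot\|_2$, respectively. For all $a,b>0$ and all independent identically distributed $\mathbb{R}^d$-valued random variables $X,Y$, $$\mathbb{P}(\|X+Y\|_2\le b)\le N(B_2(b),B_1(a),1/2)\cdot \mathbb{P}(\|X-Y\|_1\le a)$$ and $$\mathbb{P}(\|X-Y\|_2\le b)\le \left[N(B_2(b)\setminus B_1(a),B_1(a),1/2)+1\right]\cdot \mathbb{P}(\|X-Y\|_1\le a).$$
   Context: Here $\|\cdot\|_1$ and $\|\cdot\|_2$ denote two arbitrary norms (not specifically the $\ell_1$ and $\ell_2$ norms). For $F,K\subseteq\mathbb{R}^d$ and $\rho>0$, the $\rho$-covering number of $F$ by $K$ is $$N(F,K,\rho)=\inf\{|A|: A\subseteq\mathbb{R}^d,\ F\subseteq A+\rho K\},$$ where $|A|$ is the cardinality of $A$ and $A+\rho K=\{a+\rho k: a\in A,\ k\in K\}$. $F\setminus K$ is the set of elements of $F$ not in $K$. *)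

theory Defs
  imports "HOL-Probability.Probability"
begin

definition is_norm :: "('a::real_vector \<Rightarrow> real) \<Rightarrow> bool" where
  "is_norm \<nu> \<longleftrightarrow>
     (\<forall>x. 0 \<le> \<nu> x) \<and>
     (\<forall>x. \<nu> x = 0 \<longleftrightarrow> x = 0) \<and>
     (\<forall>c x. \<nu> (c *\<^sub>R x) = \<bar>c\<bar> * \<nu> x) \<and>
     (\<forall>x y. \<nu> (x + y) \<le> \<nu> x + \<nu> y)"

definition norm_ball :: "('a \<Rightarrow> real) \<Rightarrow> real \<Rightarrow> 'a set" where
  "norm_ball \<nu> r = {x. \<nu> x \<le> r}"

(* HOL's card sends infinite sets to 0, which would make every infinite cover free. *)
definition ecard :: "'a set \<Rightarrow> enat" where
  "ecard A = (if finite A then enat (card A) else \<infinity>)"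

(* The centres A range over arbitrary subsets of the whole space, not just of F. *)
definition covering_number :: "'a::real_vector set \<Rightarrow> 'a set \<Rightarrow> real \<Rightarrow> enat" where
  "covering_number F K \<rho> =
     Inf {ecard A | A. F \<subseteq> {a + \<rho> *\<^sub>R k | a k. a \<in> A \<and> k \<in> K}}"

end

theory Submission
  imports Defs
begin

text \<open>
  The inequality is the limit of a counting inequality for finite samples. In a sample of \<open>m\<close> points
  call two of them close if their difference lies in \<open>K = B\<^sub>1(a)\<close>, and let \<open>p\<close> be a point with the
  maximal number \<open>t\<close> of close points. Each translate of \<open>K/2\<close> contains at most \<open>t\<close> sample points, as
  they are all close to any one of them. A cover by \<open>N\<close> translates thus bounds the number of \<open>j\<close> with
  \<open>x\<^sub>p + x\<^sub>j \<in> F\<close> by \<open>N t\<close>, while \<open>p\<close> takes part in \<open>2 t - 1\<close> ordered close pairs. Removing \<open>p\<close> and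
  iterating gives #sum pairs \<open>\<le>\<close> N #close pairs + O(m). For an i.i.d. sample, take expectations, divide
  by \<open>m\<^sup>2\<close> and let \<open>m\<close> tend to infinity. For differences, the points close to \<open>p\<close> itself supply
  one more set with at most \<open>t\<close> sample points, which accounts for the summand 1.
\<close>

section \<open>Counting related pairs in a finite sample\<close>

text \<open>Only the combinatorics of the cover matters, so sums and differences are treated alike
  through an abstract relation \<open>S\<close>. A piece \<open>c\<close> is either a clique of
  \<open>T\<close> or part of the \<open>T\<close>-neighbourhood of \<open>y\<close> itself; the
  second kind is for the extra summand 1 in the bound for differences.\<close>

lemma card_related_pairs_le:
  fixes x :: "'i \<Rightarrow> 'a" and S T :: "('a \<times> 'a) set"
  assumes "finite J" and "sym S" and "sym T"
    and cover: "\<And>y. \<exists>C. finite C \<and> card C \<le> n \<and> S `` {y} \<subseteq> \<Union>C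
                   \<and> (\<forall>c\<in>C. c \<times> c \<subseteq> T \<or> c \<subseteq> T `` {y})"
  shows "card {(i, j). i \<in> J \<and> j \<in> J \<and> (x i, x j) \<in> S}
           \<le> n * card {(i, j). i \<in> J \<and> j \<in> J \<and> (x i, x j) \<in> T} + n * card J"
  using \<open>finite J\<close>
proof (induction "card J" arbitrary: J)
  case 0
  then show ?case by auto
next
  case (Suc k)
  define pairs where "pairs R L = {(i, j). i \<in> L \<and> j \<in> L \<and> (x i, x j) \<in> R}" for R L
  define deg where "deg i = card {j \<in> J. (x i, x j) \<in> T}" for i
  have fin: "finite J" by fact
  have fin_pairs: "finite (pairs R L)" if "L \<subseteq> J" for R L
    by (rule finite_subset[of _ "J \<times> J"]) (use that fin in \<open>auto simp: pairs_def\<close>)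
  have "J \<noteq> {}" using Suc by auto
  then obtain p where p: "p \<in> J" and deg_le: "\<And>i. i \<in> J \<Longrightarrow> deg i \<le> deg p"
    using Max_in[of "deg ` J"] Max_ge[of "deg ` J"] fin by (metis (no_types, lifting)
        finite_imageI image_is_empty image_iff imageI)
  define L where "L = J - {p}"
  define A where "A = {j \<in> J. (x p, x j) \<in> S}"
  define B where "B = {j \<in> J. (x p, x j) \<in> T}"
  have L: "L \<subseteq> J" "finite L" "card L = k" "card J = Suc (card L)" "p \<notin> L"
    using Suc p fin by (auto simp: L_def)
  have finAB: "finite A" "finite B" using fin by (auto simp: A_def B_def)

  have "card A \<le> n * card B"
  proof -
    obtain C where C: "finite C" "card C \<le> n" "S `` {x p} \<subseteq> \<Union>C"
      and C': "\<And>c. c \<in> C \<Longrightarrow> c \<times> c \<subseteq> T \<or> c \<subseteq> T `` {x p}"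
      using cover[of "x p"] by blast
    have "A \<subseteq> (\<Union>c\<in>C. {j \<in> J. x j \<in> c})"
      using C(3) by (auto simp: A_def)
    then have "card A \<le> card (\<Union>c\<in>C. {j \<in> J. x j \<in> c})"
      using C(1) fin by (intro card_mono) auto
    also have "\<dots> \<le> (\<Sum>c\<in>C. card {j \<in> J. x j \<in> c})"
      using C(1) by (rule card_UN_le)
    also have "\<dots> \<le> (\<Sum>c\<in>C. card B)"
    proof (rule sum_mono)
      fix c assume c: "c \<in> C"
      show "card {j \<in> J. x j \<in> c} \<le> card B"
      \<comment> \<open>A clique that contains a sample point \<open>x i\<close> lies in the
        neighbourhood of \<open>x i\<close>, so the maximality of \<open>deg p\<close> applies. A
        clique without sample points goes to the second case, where the inclusion in
        \<open>B\<close> is trivial.\<close>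
      proof (cases "c \<times> c \<subseteq> T \<and> {j \<in> J. x j \<in> c} \<noteq> {}")
        case True
        then obtain i where i: "i \<in> J" "x i \<in> c" by auto
        have "card {j \<in> J. x j \<in> c} \<le> deg i"
          unfolding deg_def using True i fin by (intro card_mono) auto
        then show ?thesis
          using deg_le[OF i(1)] by (simp add: deg_def B_def)
      next
        case False
        then have "{j \<in> J. x j \<in> c} \<subseteq> B"
          using C'[OF c] by (auto simp: B_def)
        then show ?thesis using finAB by (intro card_mono) auto
      qed
    qed
    also have "\<dots> \<le> n * card B" using C(2) by simp
    finally show ?thesis .
  qed
  moreover have "card (pairs S J) \<le> card (pairs S L) + 2 * card A"
  proof -
    \<comment> \<open>The pairs lost with \<open>p\<close> form a row and a column, each in
      bijection with \<open>A\<close> by symmetry; an overlap at \<open>(p, p)\<close> is harmless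
      for an upper bound.\<close>
    have "pairs S J \<subseteq> pairs S L \<union> (Pair p ` A \<union> (\<lambda>j. (j, p)) ` A)"
      using \<open>sym S\<close> by (auto simp: pairs_def L_def A_def dest: symD)
    then have "card (pairs S J) \<le> card (pairs S L \<union> (Pair p ` A \<union> (\<lambda>j. (j, p)) ` A))"
      using fin_pairs[OF L(1)] finAB by (intro card_mono) auto
    also have "\<dots> \<le> card (pairs S L) + (card (Pair p ` A) + card ((\<lambda>j. (j, p)) ` A))"
      by (meson card_Un_le add_left_mono order_trans)
    also have "\<dots> \<le> card (pairs S L) + (card A + card A)"
      using finAB by (intro add_mono card_image_le order_refl)
    finally show ?thesis by simp
  qed
  moreover have "card (pairs T L) + 2 * card B \<le> card (pairs T J) + 1"
  proof -
    \<comment> \<open>In this lower bound \<open>(p, p)\<close> may count only once, hence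
      \<open>B - {p}\<close> in the column. The deficit of at most 1 per removed point, multiplied
      by \<open>n\<close>, adds up to the term \<open>n * card J\<close>.\<close>
    have "card (pairs T L \<union> (Pair p ` B \<union> (\<lambda>j. (j, p)) ` (B - {p}))) \<le> card (pairs T J)"
      using \<open>sym T\<close> p L fin by (intro card_mono fin_pairs) (auto simp: pairs_def B_def dest: symD)
    moreover have "card (pairs T L \<union> (Pair p ` B \<union> (\<lambda>j. (j, p)) ` (B - {p})))
        = card (pairs T L) + card (Pair p ` B \<union> (\<lambda>j. (j, p)) ` (B - {p}))"
      using finAB fin_pairs[OF L(1)] L by (intro card_Un_disjoint) (auto simp: pairs_def)
    moreover have "card (Pair p ` B \<union> (\<lambda>j. (j, p)) ` (B - {p}))
        = card (Pair p ` B) + card ((\<lambda>j. (j, p)) ` (B - {p}))"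
      using finAB by (intro card_Un_disjoint) auto
    moreover have "card (Pair p ` B) = card B" "card ((\<lambda>j. (j, p)) ` (B - {p})) = card (B - {p})"
      by (auto intro!: card_image simp: inj_on_def)
    moreover have "card B \<le> card (B - {p}) + 1"
      using finAB by (cases "p \<in> B") (use card_Suc_Diff1[of B p] in simp_all)
    ultimately show ?thesis by linarith
  qed
  moreover have "card (pairs S L) \<le> n * card (pairs T L) + n * card L"
    using Suc.hyps(1)[of L] L by (simp add: pairs_def)
  ultimately have "card (pairs S J) \<le> n * card (pairs T L) + n * card L + 2 * (n * card B)"
    by linarith
  also have "\<dots> = n * (card (pairs T L) + 2 * card B) + n * card L"
    by (simp add: algebra_simps)
  also have "\<dots> \<le> n * (card (pairs T J) + 1) + n * card L"
    using \<open>card (pairs T L) + 2 * card B \<le> _\<close> by (intro add_right_mono mult_left_mono) auto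
  finally show ?case
    using L by (simp add: pairs_def algebra_simps)
qed

section \<open>Pairs of coordinates in an i.i.d. sample\<close>

text \<open>The preimage of a rectangle is a cylinder over two distinct coordinates, and the product
  measure factorizes on cylinders. For \<open>i = j\<close> the law would sit on the diagonal
  instead.\<close>

lemma (in prob_space) distr_PiM_pair:
  assumes "i \<in> I" and "j \<in> I" and "i \<noteq> j"
  shows "distr (Pi\<^sub>M I (\<lambda>_. M)) (M \<Otimes>\<^sub>M M) (\<lambda>\<omega>. (\<omega> i, \<omega> j)) = M \<Otimes>\<^sub>M M"
proof -
  interpret P: product_prob_space "\<lambda>_. M" I
    by unfold_locales
  have [measurable]: "(\<lambda>\<omega>. \<omega> i) \<in> Pi\<^sub>M I (\<lambda>_. M) \<rightarrow>\<^sub>M M" "(\<lambda>\<omega>. \<omega> j) \<in> Pi\<^sub>M I (\<lambda>_. M) \<rightarrow>\<^sub>M M"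
    using assms by auto
  show ?thesis
  proof (rule pair_measure_eqI[symmetric])
    show "sigma_finite_measure M" "sigma_finite_measure M"
      by unfold_locales
    fix A B assume AB [measurable]: "A \<in> sets M" "B \<in> sets M"
    have "emeasure (distr (Pi\<^sub>M I (\<lambda>_. M)) (M \<Otimes>\<^sub>M M) (\<lambda>\<omega>. (\<omega> i, \<omega> j))) (A \<times> B)
        = emeasure (Pi\<^sub>M I (\<lambda>_. M))
            {\<omega> \<in> space (Pi\<^sub>M I (\<lambda>_. M)). \<forall>k\<in>{i, j}. \<omega> k \<in> (if k = i then A else B)}"
      using assms by (subst emeasure_distr) (auto intro!: arg_cong2[where f = emeasure])
    also have "\<dots> = (\<Prod>k\<in>{i, j}. emeasure M (if k = i then A else B))"
      using assms AB by (intro P.emeasure_PiM_Collect) auto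
    also have "\<dots> = emeasure M A * emeasure M B"
      using assms by simp
    finally show "emeasure M A * emeasure M B
        = emeasure (distr (Pi\<^sub>M I (\<lambda>_. M)) (M \<Otimes>\<^sub>M M) (\<lambda>\<omega>. (\<omega> i, \<omega> j))) (A \<times> B)" ..
  qed simp
qed

text \<open>The count is a sum of indicators over \<open>m * (m - 1)\<close> ordered pairs of
  distinct indices, each with expectation \<open>measure (M \<Otimes>\<^sub>M M) R\<close>. At
  \<open>m = 0\<close> the truncated subtraction does no harm, since the factor
  \<open>real m\<close> vanishes.\<close>

lemma (in prob_space) integral_PiM_card_pairs:
  assumes [measurable]: "R \<in> sets (M \<Otimes>\<^sub>M M)"
  shows "integrable (Pi\<^sub>M {..<m} (\<lambda>_. M))
            (\<lambda>\<omega>. real (card {(i, j). i < m \<and> j < m \<and> i \<noteq> j \<and> (\<omega> i, \<omega> j) \<in> R}))" (is ?int)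
    and "(\<integral>\<omega>. real (card {(i, j). i < m \<and> j < m \<and> i \<noteq> j \<and> (\<omega> i, \<omega> j) \<in> R}) \<partial>Pi\<^sub>M {..<m} (\<lambda>_. M))
            = real m * real (m - 1) * measure (M \<Otimes>\<^sub>M M) R" (is ?eq)
proof -
  interpret P: product_prob_space "\<lambda>_. M" "{..<m}"
    by unfold_locales
  let ?P = "Pi\<^sub>M {..<m} (\<lambda>_. M)"
  have card_eq: "real (card {(i, j). i < m \<and> j < m \<and> i \<noteq> j \<and> (\<omega> i, \<omega> j) \<in> R})
      = (\<Sum>i<m. \<Sum>j\<in>{..<m} - {i}. indicator R (\<omega> i, \<omega> j))" for \<omega> :: "nat \<Rightarrow> 'a"
  proof -
    have "{(i, j). i < m \<and> j < m \<and> i \<noteq> j \<and> (\<omega> i, \<omega> j) \<in> R}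
        = (SIGMA i:{..<m}. {j \<in> {..<m} - {i}. (\<omega> i, \<omega> j) \<in> R})"
      by auto
    then show ?thesis
      by (simp add: card_SigmaI indicator_def sum.If_cases Int_def of_nat_sum)
  qed
  have meas [measurable]: "(\<lambda>\<omega>. (\<omega> i, \<omega> j)) \<in> ?P \<rightarrow>\<^sub>M M \<Otimes>\<^sub>M M" if "i < m" "j < m" for i j
    using that by (intro measurable_Pair measurable_component_singleton) auto
  have int: "integrable ?P (\<lambda>\<omega>. indicator R (\<omega> i, \<omega> j) :: real)" if "i < m" "j < m" for i j
    using meas[OF that]
    by (intro P.P.integrable_const_bound[where B = 1]) (auto split: split_indicator)
  have eq: "(\<integral>\<omega>. indicator R (\<omega> i, \<omega> j) \<partial>?P) = measure (M \<Otimes>\<^sub>M M) R"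
    if "i < m" "j < m" "i \<noteq> j" for i j
  proof -
    have "(\<integral>\<omega>. indicat_real R (\<omega> i, \<omega> j) \<partial>?P)
        = (\<integral>z. indicat_real R z \<partial>distr ?P (M \<Otimes>\<^sub>M M) (\<lambda>\<omega>. (\<omega> i, \<omega> j)))"
      using meas[OF that(1,2)] by (intro integral_distr[symmetric]) auto
    also have "\<dots> = measure (M \<Otimes>\<^sub>M M) R"
      using that by (subst distr_PiM_pair) auto
    finally show ?thesis .
  qed
  show ?int
    unfolding card_eq using int by (intro Bochner_Integration.integrable_sum) auto
  have "(\<integral>\<omega>. (\<Sum>i<m. \<Sum>j\<in>{..<m} - {i}. indicat_real R (\<omega> i, \<omega> j)) \<partial>?P)
      = (\<Sum>i<m. \<Sum>j\<in>{..<m} - {i}. \<integral>\<omega>. indicat_real R (\<omega> i, \<omega> j) \<partial>?P)"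
    using int
    by (subst Bochner_Integration.integral_sum, force intro!: Bochner_Integration.integrable_sum)
      (intro sum.cong refl Bochner_Integration.integral_sum, auto)
  also have "\<dots> = (\<Sum>i<m. \<Sum>j\<in>{..<m} - {i}. measure (M \<Otimes>\<^sub>M M) R)"
    using eq by (intro sum.cong refl) auto
  also have "\<dots> = real m * real (m - 1) * measure (M \<Otimes>\<^sub>M M) R"
    by (cases m) simp_all
  finally show ?eq unfolding card_eq .
qed

section \<open>From counting to probabilities\<close>

text \<open>Main terms of the expected counting bound are of order \<open>m^2\<close> while the
  error is linear in \<open>m\<close>, so the error disappears in the limit.\<close>

lemma (in prob_space) measure_pair_le_of_cover:
  assumes "S \<in> sets (M \<Otimes>\<^sub>M M)" and "T \<in> sets (M \<Otimes>\<^sub>M M)" and "sym S" and "sym T"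
    and cover: "\<And>y. \<exists>C. finite C \<and> card C \<le> n \<and> S `` {y} \<subseteq> \<Union>C
                   \<and> (\<forall>c\<in>C. c \<times> c \<subseteq> T \<or> c \<subseteq> T `` {y})"
  shows "measure (M \<Otimes>\<^sub>M M) S \<le> real n * measure (M \<Otimes>\<^sub>M M) T"
proof -
  let ?s = "measure (M \<Otimes>\<^sub>M M) S" and ?t = "measure (M \<Otimes>\<^sub>M M) T"
  \<comment> \<open>This is the expected bound for \<open>m = Suc k\<close> points, divided by
    \<open>m\<close>. One \<open>n\<close> of the error comes from the counting lemma, the other
    from the diagonal pairs in \<open>T\<close>, which must be split off before expectations are
    taken.\<close>
  have bound: "real k * ?s \<le> real n * (real k * ?t) + 2 * real n" for k
  proof -
    define m where "m = Suc k"
    interpret P: product_prob_space "\<lambda>_. M" "{..<m}"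
      by unfold_locales
    let ?P = "Pi\<^sub>M {..<m} (\<lambda>_. M)"
    let ?off = "\<lambda>R \<omega>. real (card {(i, j). i < m \<and> j < m \<and> i \<noteq> j \<and> (\<omega> i, \<omega> j) \<in> R})"
    have "?off S \<omega> \<le> real n * ?off T \<omega> + 2 * real n * real m" for \<omega> :: "nat \<Rightarrow> 'a"
    proof -
      let ?all = "\<lambda>R. {(i, j). i \<in> {..<m} \<and> j \<in> {..<m} \<and> (\<omega> i, \<omega> j) \<in> R}"
      let ?o = "\<lambda>R. {(i, j). i < m \<and> j < m \<and> i \<noteq> j \<and> (\<omega> i, \<omega> j) \<in> R}"
      have fin: "finite (?all R)" "finite (?o R)" for R
        by (rule finite_subset[of _ "{..<m} \<times> {..<m}"]; auto)+
      have "card (?o S) \<le> card (?all S)"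
        using fin by (intro card_mono) auto
      also have "\<dots> \<le> n * card (?all T) + n * card {..<m}"
        by (rule card_related_pairs_le[OF _ \<open>sym S\<close> \<open>sym T\<close> cover]) auto
      also have "card (?all T) \<le> card (?o T \<union> (\<lambda>i. (i, i)) ` {..<m})"
        using fin by (intro card_mono) auto
      also have "\<dots> \<le> card (?o T) + m"
        by (metis (lifting) card_Un_le card_image_le card_lessThan add_left_mono finite_lessThan
            order_trans)
      finally have "card (?o S) \<le> n * card (?o T) + 2 * n * m"
        by (simp add: algebra_simps)
      then have "real (card (?o S)) \<le> real (n * card (?o T) + 2 * n * m)"
        by (simp only: of_nat_le_iff)
      then show ?thesis by simp
    qed
    then have "(\<integral>\<omega>. ?off S \<omega> \<partial>?P) \<le> (\<integral>\<omega>. real n * ?off T \<omega> + 2 * real n * real m \<partial>?P)"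
      using integral_PiM_card_pairs(1)[of _ m] assms(1,2)
      by (intro integral_mono Bochner_Integration.integrable_add integrable_mult_right) auto
    also have "\<dots> = real n * (\<integral>\<omega>. ?off T \<omega> \<partial>?P) + 2 * real n * real m"
      using integral_PiM_card_pairs(1)[of T m] assms(2)
      by (subst Bochner_Integration.integral_add) (auto simp: P.P.prob_space)
    finally have "real m * (real k * ?s) \<le> real m * (real n * (real k * ?t) + 2 * real n)"
      using integral_PiM_card_pairs(2)[of _ m] assms(1,2) by (simp add: m_def algebra_simps)
    then show ?thesis
      by (subst (asm) mult_le_cancel_left_pos) (auto simp: m_def)
  qed
  show ?thesis
  proof (rule ccontr)
    assume "\<not> ?thesis"
    then have pos: "?s - real n * ?t > 0" by simp
    \<comment> \<open>If the claim failed, the gap between the two sides, multiplied by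
      \<open>k\<close>, would outgrow the constant error.\<close>
    obtain k where "2 * real n < real k * (?s - real n * ?t)"
      using reals_Archimedean3[OF pos] by blast
    then show False using bound[of k] by (simp add: algebra_simps)
  qed
qed

section \<open>Arbitrary norms: continuity and positive probability of small differences\<close>

lemma is_norm_minus_commute:
  assumes "is_norm \<nu>"
  shows "\<nu> (x - y) = \<nu> (y - x)"
proof -
  have "\<nu> ((-1) *\<^sub>R (y - x)) = \<bar>-1\<bar> * \<nu> (y - x)"
    using assms unfolding is_norm_def by blast
  then show ?thesis by simp
qed

lemma is_norm_scaleR:
  assumes "is_norm \<nu>"
  shows "\<nu> (c *\<^sub>R x) = \<bar>c\<bar> * \<nu> x"
  using assms unfolding is_norm_def by blast

lemma is_norm_triangle:
  assumes "is_norm \<nu>"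
  shows "\<nu> (x - z) \<le> \<nu> (x - y) + \<nu> (y - z)"
proof -
  have "\<nu> ((x - y) + (y - z)) \<le> \<nu> (x - y) + \<nu> (y - z)"
    using assms unfolding is_norm_def by blast
  then show ?thesis by simp
qed

text \<open>A norm is convex, and a finite convex function on a finite-dimensional space is
  continuous. This makes the events measurable and the strict balls open.\<close>

lemma is_norm_continuous:
  fixes \<nu> :: "'a::euclidean_space \<Rightarrow> real"
  assumes "is_norm \<nu>"
  shows "continuous_on UNIV \<nu>"
proof (rule convex_on_continuous)
  show "convex_on UNIV \<nu>"
  proof (rule convex_onI)
    fix t :: real and x y :: 'a assume t: "0 < t" "t < 1"
    have "\<nu> ((1 - t) *\<^sub>R x + t *\<^sub>R y) \<le> \<nu> ((1 - t) *\<^sub>R x) + \<nu> (t *\<^sub>R y)"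
      using assms unfolding is_norm_def by blast
    also have "\<dots> = (1 - t) * \<nu> x + t * \<nu> y"
      using t by (simp add: is_norm_scaleR[OF assms])
    finally show "\<nu> ((1 - t) *\<^sub>R x + t *\<^sub>R y) \<le> (1 - t) * \<nu> x + t * \<nu> y" .
  qed simp
qed simp

text \<open>Excludes the product \<open>\<infinity> * 0 = 0\<close> when the covering number is infinite. (It never is, but
  this way the compactness of norm balls is not needed.)\<close>

lemma measure_pair_norm_diff_pos:
  fixes \<nu> :: "'a::euclidean_space \<Rightarrow> real"
  assumes \<nu>: "is_norm \<nu>" and a: "a > 0" and "prob_space M" and sets_M: "sets M = sets borel"
  shows "measure (M \<Otimes>\<^sub>M M) {(x, y). \<nu> (x - y) \<le> a} > 0"
proof -
  interpret M: prob_space M by fact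
  interpret MM: pair_prob_space M M by unfold_locales
  note [measurable_cong] = sets_M
  have [measurable]: "\<nu> \<in> borel_measurable borel"
    using is_norm_continuous[OF \<nu>] by (rule borel_measurable_continuous_onI)
  \<comment> \<open>Two points in the same ball of radius \<open>a / 2\<close> differ by at most
    \<open>a\<close>, so one ball \<open>U q\<close> of positive mass suffices. It exists because
    countably many of the balls cover the space.\<close>
  define U where "U q = {x. \<nu> (x - q) < a / 2}" for q
  have open_U: "open (U q)" for q
    unfolding U_def
    by (intro open_Collect_less continuous_on_const
        continuous_on_compose2[OF is_norm_continuous[OF \<nu>]] continuous_intros) auto
  have "\<nu> 0 = 0" using \<nu> unfolding is_norm_def by blast
  then have UN_U: "(\<Union>q. U q) = UNIV"
    using a by (force simp: U_def)
  obtain F where F: "F \<subseteq> range U" "countable F" "\<Union>F = \<Union>(range U)"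
    using Lindelof[of "range U"] open_U by blast
  have "\<exists>q. emeasure M (U q) \<noteq> 0"
  proof (rule ccontr)
    assume "\<not> ?thesis"
    then have "(\<Union>B\<in>F. B) \<in> null_sets M"
      using F open_U by (intro null_sets_UN' F) (auto simp: null_sets_def sets_M)
    then have "emeasure M UNIV = 0"
      using F UN_U by (simp add: null_sets_def)
    moreover have "space M = UNIV" using sets_eq_imp_space_eq[OF sets_M] by simp
    ultimately show False using M.emeasure_space_1 by simp
  qed
  then obtain q where q: "emeasure M (U q) \<noteq> 0" by blast
  have [measurable]: "U q \<in> sets M" using open_U by (simp add: sets_M)
  have "{(x, y). \<nu> (x - y) \<le> a} = {z \<in> space (M \<Otimes>\<^sub>M M). \<nu> (fst z - snd z) \<le> a}"
    using sets_eq_imp_space_eq[OF sets_M] by (auto simp: space_pair_measure)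
  also have "\<dots> \<in> sets (M \<Otimes>\<^sub>M M)" by measurable
  finally have meas: "{(x, y). \<nu> (x - y) \<le> a} \<in> sets (M \<Otimes>\<^sub>M M)" .
  have sub: "U q \<times> U q \<subseteq> {(x, y). \<nu> (x - y) \<le> a}"
  proof clarsimp
    fix x y assume "x \<in> U q" "y \<in> U q"
    then show "\<nu> (x - y) \<le> a"
      using is_norm_triangle[OF \<nu>, of x y q] is_norm_minus_commute[OF \<nu>, of q y]
      by (simp add: U_def)
  qed
  have "0 < emeasure (M \<Otimes>\<^sub>M M) (U q \<times> U q)"
    using q by (subst M.emeasure_pair_measure_Times) (auto simp: zero_less_iff_neq_zero)
  also have "\<dots> \<le> emeasure (M \<Otimes>\<^sub>M M) {(x, y). \<nu> (x - y) \<le> a}"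
    using sub meas by (rule emeasure_mono)
  finally show ?thesis
    by (simp add: MM.emeasure_eq_measure)
qed

section \<open>Covering numbers and half-size balls\<close>

text \<open>A finite infimum in \<open>enat\<close> is attained: the set is nonempty, as the empty
  infimum is infinite, and \<open>enat\<close> is well-ordered.\<close>

lemma covering_number_witness:
  assumes "covering_number F K \<rho> = enat n"
  obtains A where "finite A" and "card A = n" and "F \<subseteq> {a + \<rho> *\<^sub>R k | a k. a \<in> A \<and> k \<in> K}"
proof -
  let ?E = "{ecard A | A. F \<subseteq> {a + \<rho> *\<^sub>R k | a k. a \<in> A \<and> k \<in> K}}"
  have "enat n = Inf ?E" using assms unfolding covering_number_def by simp
  moreover have "?E \<noteq> {}"
    using calculation by (auto simp: Inf_enat_def simp del: Collect_empty_eq split: if_splits)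
  ultimately have "enat n \<in> ?E"
    by (metis (lifting) Inf_enat_def LeastI_ex all_not_in_conv)
  then obtain A where "enat n = ecard A" "F \<subseteq> {a + \<rho> *\<^sub>R k | a k. a \<in> A \<and> k \<in> K}"
    by blast
  then show thesis
    by (intro that[of A]) (auto simp: ecard_def split: if_splits)
qed

text \<open>This is where the scale 1/2 of the covers is used: each of the two points is within
  \<open>a / 2\<close> of the centre \<open>c\<close>.\<close>

lemma half_ball_translate_clique:
  assumes \<nu>: "is_norm \<nu>" and "k \<in> norm_ball \<nu> a" and "l \<in> norm_ball \<nu> a"
  shows "\<nu> ((c + (1/2) *\<^sub>R k) - (c + (1/2) *\<^sub>R l)) \<le> a"
proof -
  have "\<nu> ((1/2) *\<^sub>R k - (1/2) *\<^sub>R l) \<le> \<nu> ((1/2) *\<^sub>R k - 0) + \<nu> (0 - (1/2) *\<^sub>R l)"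
    by (rule is_norm_triangle[OF \<nu>])
  also have "\<nu> (0 - (1/2) *\<^sub>R l) = \<nu> ((1/2) *\<^sub>R l - 0)"
    by (rule is_norm_minus_commute[OF \<nu>])
  also have "\<nu> ((1/2) *\<^sub>R k - 0) + \<nu> ((1/2) *\<^sub>R l - 0) \<le> a"
    using assms(2,3) by (simp add: is_norm_scaleR[OF \<nu>] norm_ball_def)
  finally show ?thesis by simp
qed

section \<open>The two inequalities for \<open>X\<close> and \<open>Y\<close>\<close>

theorem corollary1:
  fixes M :: "'w measure"
    and X Y :: "'w \<Rightarrow> real ^ 'd"
    and norm1 norm2 :: "real ^ 'd \<Rightarrow> real"
    and a b :: real
  assumes "is_norm norm1" and "is_norm norm2"
    and "a > 0" and "b > 0"
    and "prob_space M"
    and "X \<in> borel_measurable M" and "Y \<in> borel_measurable M"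
    and "prob_space.indep_var M borel X borel Y"
    and "distr M borel X = distr M borel Y"
  shows "ennreal (\<P>(\<omega> in M. norm2 (X \<omega> + Y \<omega>) \<le> b))
           \<le> ennreal_of_enat (covering_number (norm_ball norm2 b) (norm_ball norm1 a) (1/2))
             * ennreal (\<P>(\<omega> in M. norm1 (X \<omega> - Y \<omega>) \<le> a))
       \<and> ennreal (\<P>(\<omega> in M. norm2 (X \<omega> - Y \<omega>) \<le> b))
           \<le> ennreal_of_enat (covering_number (norm_ball norm2 b - norm_ball norm1 a)
                                (norm_ball norm1 a) (1/2) + 1)
             * ennreal (\<P>(\<omega> in M. norm1 (X \<omega> - Y \<omega>) \<le> a))"
proof -
  interpret prob_space M by fact
  note norm1 = \<open>is_norm norm1\<close> and norm2 = \<open>is_norm norm2\<close>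
  note [measurable] = \<open>X \<in> borel_measurable M\<close> \<open>Y \<in> borel_measurable M\<close>
  have [measurable]: "norm1 \<in> borel_measurable borel" "norm2 \<in> borel_measurable borel"
    using norm1 norm2 by (auto intro!: borel_measurable_continuous_onI is_norm_continuous)
  define D where "D = distr M borel X"
  interpret D: prob_space D unfolding D_def by (rule prob_space_distr) simp
  have sets_D [measurable_cong]: "sets D = sets borel" by (simp add: D_def)
  have space_D: "space D = UNIV" by (simp add: D_def)
  define T where "T = {(x, y). norm1 (x - y) \<le> a}"
  define Sp where "Sp = {(x, y). norm2 (x + y) \<le> b}"
  define Sm where "Sm = {(x, y). norm2 (x - y) \<le> b}"

  have "T = {z \<in> space (D \<Otimes>\<^sub>M D). norm1 (fst z - snd z) \<le> a}"
    "Sp = {z \<in> space (D \<Otimes>\<^sub>M D). norm2 (fst z + snd z) \<le> b}"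
    "Sm = {z \<in> space (D \<Otimes>\<^sub>M D). norm2 (fst z - snd z) \<le> b}"
    by (auto simp: space_pair_measure space_D T_def Sp_def Sm_def)
  then have meas: "T \<in> sets (D \<Otimes>\<^sub>M D)" "Sp \<in> sets (D \<Otimes>\<^sub>M D)" "Sm \<in> sets (D \<Otimes>\<^sub>M D)"
    by simp_all
  have sym: "sym T" "sym Sp" "sym Sm"
    using is_norm_minus_commute[OF norm1] is_norm_minus_commute[OF norm2]
    by (auto intro!: symI simp: T_def Sp_def Sm_def add.commute)
  \<comment> \<open>Independence makes the joint law a product, and equality of the marginals makes
    both factors \<open>D\<close>; the events thus become relations on pairs drawn from
    \<open>D\<close>.\<close>
  have DD: "D \<Otimes>\<^sub>M D = distr M (borel \<Otimes>\<^sub>M borel) (\<lambda>\<omega>. (X \<omega>, Y \<omega>))"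
    using \<open>indep_var borel X borel Y\<close> \<open>distr M borel X = distr M borel Y\<close>
    by (simp add: indep_var_distribution_eq D_def)
  have prob_eq: "measure (D \<Otimes>\<^sub>M D) R = \<P>(\<omega> in M. (X \<omega>, Y \<omega>) \<in> R)"
    if "R \<in> sets (D \<Otimes>\<^sub>M D)" for R
    using that unfolding DD by (subst measure_distr) (auto intro!: arg_cong2[where f = measure])
  have probs: "\<P>(\<omega> in M. norm1 (X \<omega> - Y \<omega>) \<le> a) = measure (D \<Otimes>\<^sub>M D) T"
    "\<P>(\<omega> in M. norm2 (X \<omega> + Y \<omega>) \<le> b) = measure (D \<Otimes>\<^sub>M D) Sp"
    "\<P>(\<omega> in M. norm2 (X \<omega> - Y \<omega>) \<le> b) = measure (D \<Otimes>\<^sub>M D) Sm"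
    using prob_eq meas by (simp_all add: T_def Sp_def Sm_def)
  have pos: "measure (D \<Otimes>\<^sub>M D) T > 0"
    unfolding T_def by (rule measure_pair_norm_diff_pos[OF norm1 \<open>a > 0\<close> D.prob_space_axioms sets_D])

  define clq where "clq c = {c + (1/2) *\<^sub>R k | k. k \<in> norm_ball norm1 a}" for c
  have clq: "clq c \<times> clq c \<subseteq> T" for c
    using half_ball_translate_clique[OF norm1, of _ a _ c] by (auto simp: clq_def T_def)
  have to_ennreal: "ennreal s \<le> ennreal_of_enat N * ennreal (measure (D \<Otimes>\<^sub>M D) T)"
    if "\<And>n. N = enat n \<Longrightarrow> s \<le> real n * measure (D \<Otimes>\<^sub>M D) T" for s N
  proof (cases N)
    case (enat n)
    then have "ennreal s \<le> ennreal (real n * measure (D \<Otimes>\<^sub>M D) T)"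
      using that by (intro ennreal_leI) auto
    then show ?thesis
      using enat by (simp add: ennreal_mult ennreal_of_nat_eq_real_of_nat)
  next
    case infinity
    then show ?thesis using pos by (simp add: ennreal_top_mult)
  qed

  have "measure (D \<Otimes>\<^sub>M D) Sp \<le> real n * measure (D \<Otimes>\<^sub>M D) T"
    if n: "covering_number (norm_ball norm2 b) (norm_ball norm1 a) (1/2) = enat n" for n
  proof (rule D.measure_pair_le_of_cover[OF meas(2,1) sym(2,1)])
    fix x
    obtain A where A: "finite A" "card A = n" and cov:
      "norm_ball norm2 b \<subseteq> {c + (1/2) *\<^sub>R k | c k. c \<in> A \<and> k \<in> norm_ball norm1 a}"
      using covering_number_witness[OF n] .
    \<comment> \<open>For fixed \<open>x\<close> the partners \<open>y\<close> fill the ball shifted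
      by \<open>-x\<close>, so shifting the centres of one fixed cover serves every
      \<open>x\<close>.\<close>
    have "Sp `` {x} \<subseteq> (\<Union>c\<in>A. clq (c - x))"
    proof
      fix y assume "y \<in> Sp `` {x}"
      then have "x + y \<in> norm_ball norm2 b" by (simp add: Sp_def norm_ball_def)
      then obtain c k where "c \<in> A" "k \<in> norm_ball norm1 a" "x + y = c + (1/2) *\<^sub>R k"
        using cov by blast
      moreover from this have "y = (c - x) + (1/2) *\<^sub>R k" by (simp add: algebra_simps)
      ultimately show "y \<in> (\<Union>c\<in>A. clq (c - x))" unfolding clq_def by blast
    qed
    then show "\<exists>C. finite C \<and> card C \<le> n \<and> Sp `` {x} \<subseteq> \<Union>C
        \<and> (\<forall>c\<in>C. c \<times> c \<subseteq> T \<or> c \<subseteq> T `` {x})"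
      using A clq by (intro exI[of _ "(\<lambda>c. clq (c - x)) ` A"]) (auto simp: card_image_le)
  qed
  moreover have "measure (D \<Otimes>\<^sub>M D) Sm \<le> real n * measure (D \<Otimes>\<^sub>M D) T"
    if n: "covering_number (norm_ball norm2 b - norm_ball norm1 a) (norm_ball norm1 a) (1/2) + 1
             = enat n" for n
  proof (rule D.measure_pair_le_of_cover[OF meas(3,1) sym(3,1)])
    fix x
    obtain k where k: "covering_number (norm_ball norm2 b - norm_ball norm1 a)
        (norm_ball norm1 a) (1/2) = enat k" "n = Suc k"
      using n by (cases "covering_number (norm_ball norm2 b - norm_ball norm1 a)
        (norm_ball norm1 a) (1/2)") (auto simp: one_enat_def)
    obtain A where A: "finite A" "card A = k" and cov: "norm_ball norm2 b - norm_ball norm1 a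
        \<subseteq> {c + (1/2) *\<^sub>R k | c k. c \<in> A \<and> k \<in> norm_ball norm1 a}"
      using covering_number_witness[OF k(1)] .
    \<comment> \<open>Here the shift is by \<open>x\<close>. The removed set
      \<open>norm_ball norm1 a\<close> becomes the \<open>T\<close>-neighbourhood of
      \<open>x\<close>, which joins the cover as a single piece of the second kind and accounts for
      \<open>n = Suc k\<close>.\<close>
    have "Sm `` {x} \<subseteq> T `` {x} \<union> (\<Union>c\<in>A. clq (c + x))"
    proof
      fix y assume "y \<in> Sm `` {x}"
      then have y: "y - x \<in> norm_ball norm2 b"
        using is_norm_minus_commute[OF norm2, of y x] by (simp add: Sm_def norm_ball_def)
      show "y \<in> T `` {x} \<union> (\<Union>c\<in>A. clq (c + x))"
      proof (cases "y - x \<in> norm_ball norm1 a")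
        case True
        then show ?thesis
          using is_norm_minus_commute[OF norm1, of y x] by (simp add: T_def norm_ball_def)
      next
        case False
        then obtain c k where "c \<in> A" "k \<in> norm_ball norm1 a" "y - x = c + (1/2) *\<^sub>R k"
          using cov y by blast
        moreover from this have "y = (c + x) + (1/2) *\<^sub>R k" by (simp add: algebra_simps)
        ultimately show ?thesis unfolding clq_def by blast
      qed
    qed
    moreover have "card (insert (T `` {x}) ((\<lambda>c. clq (c + x)) ` A)) \<le> n"
      using A k(2) card_image_le[OF A(1), of "\<lambda>c. clq (c + x)"]
      by (auto simp: card_insert_if)
    ultimately show "\<exists>C. finite C \<and> card C \<le> n \<and> Sm `` {x} \<subseteq> \<Union>C
        \<and> (\<forall>c\<in>C. c \<times> c \<subseteq> T \<or> c \<subseteq> T `` {x})"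
      using A clq by (intro exI[of _ "insert (T `` {x}) ((\<lambda>c. clq (c + x)) ` A)"]) auto
  qed
  ultimately show ?thesis
    unfolding probs by (intro conjI to_ennreal) auto
qed

end
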